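(* Let $\mathcal M_0,\dots,\mathcal M_K$ be models with forward-pass costs $c_0,\dots,c_K>0$ and pairwise acceptance rates $\alpha_{i,j}\in[0,1]$. Let $\sigma=(\sigma[0]<\sigma[1]<\dots<\sigma[m])$ be an ordered subset of $\{0,\dots,K\}$ with at least two elements (so $m\ge1$) and final element $\sigma[m]=K$, and let $T=(T_0,\dots,T_{m-1})$ be positive integers. Then the expected latency per token of Hierarchical Speculative Decoding (HSD) using the models $\mathcal M_{\sigma[0]},\dots,\mathcal M_{\sigma[m]}$ with parameters $T$ is $$L(\sigma,T)=\sum_{i=0}^{m} c_{\sigma[i]}\prod_{j=i}^{m} R_{\sigma,T}(\alpha_{\sigma[j-1],\sigma[j]},j),$$ where $$R_{\sigma,T}(\alpha,n)=\begin{cases}(1-\alpha)/(1-\alpha^{T_{m-1}+1}) & \text{if } n=m,\\ \gamma(\alpha,T_{n-1},T_n) & \text{if } 1\le n<m,\\ T_0 & \text{if } n=0.\end{cases}$$ (The first argument of $R_{\sigma,T}$ is irrelevant when $n=0$.)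
   Context: Cost and acceptance model of HSD on the models $\mathcal M_{\sigma[0]},\dots,\mathcal M_{\sigma[m]}$. The number $c_i$ is the time of one forward pass of $\mathcal M_i$. Generating one token with $\mathcal M_i$ costs $c_i$, and verifying a whole batch of draft tokens with $\mathcal M_i$ also costs $c_i$. HSD is run as a call at level $m$, recursively defined as follows. - A call at level $0$: $\mathcal M_{\sigma[0]}$ generates $T_0$ tokens autoregressively, at cost $T_0c_{\sigma[0]}$, and passes them up. - A call at level $i$ with $1\le i<m$: repeat rounds until at least $T_i$ tokens in total have been produced by these rounds. In each round, one call at level $i-1$ is made, which supplies a batch of $T_{i-1}$ draft tokens; then $\mathcal M_{\sigma[i]}$ verifies the batch (cost $c_{\sigma[i]}$), and the round produces one more token than the number of draft tokens accepted before the first rejection (all $T_{i-1}$ draft tokens count as accepted if none is rejected). The call passes a batch of $T_i$ tokens up. - A call at level $m$: a single round with one call at level $m-1$ supplying $T_{m-1}$ draft tokens, and one verification by $\mathcal M_{\sigma[m]}=\mathcal M_K$ (cost $c_K$); the number of output tokens is again one more than the number of draft tokens accepted before the first rejection. Standing assumption: acceptances are i.i.d.: each draft token of $\mathcal M_{\sigma[j-1]}$ examined by $\mathcal M_{\sigma[j]}$ is accepted with probability $\alpha_{\sigma[j-1],\sigma[j]}$, independently of everything else (across tokens, rounds, calls and levels). The expected latency per token is the expected total cost of a call at level $m$ divided by the expected number of tokens output by that call. For $\alpha\in[0,1]$ and positive integers $a,b$, $\gamma(\alpha,a,b)$ is the expected number of draft-and-verify rounds needed to collect at least $b$ tokens when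 each round supplies $a$ draft tokens: $\gamma(\alpha,a,b)=\mathbb E[\min\{r\ge1: N_1+\dots+N_r\ge b\}]$, where $N_1,N_2,\dots$ are i.i.d. copies of $1+G$, with $G$ the number of tokens accepted before the first rejection among $a$ draft tokens each accepted independently with probability $\alpha$ (so $\mathbb P(G\ge g)=\alpha^g$ for $0\le g\le a$). Convention: for $\alpha=1$, $(1-\alpha)/(1-\alpha^{t+1})$ is read as its limit $1/(t+1)$. *)

theory Defs
  imports "HOL-Probability.Probability"
begin

text \<open>
  Conventions: \<open>\<sigma> i\<close> is the index of the model at level \<open>i\<close>, \<open>c k\<close> the cost of a forward
  pass of model \<open>k\<close>, and \<open>\<alpha> k l\<close> the rate at which model \<open>l\<close> accepts draft tokens of model \<open>k\<close>.
  Randomised procedures are monadic \<open>pmf\<close> programs; every sampling step uses fresh randomness,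
  which expresses the independence across tokens, rounds, calls and levels.
\<close>

definition accepted_pmf :: "real \<Rightarrow> nat \<Rightarrow> nat pmf" where
  "accepted_pmf \<alpha> a =
     map_pmf (\<lambda>accs. length (takeWhile (\<lambda>acc. acc) accs)) (replicate_pmf a (bernoulli_pmf \<alpha>))"

text \<open>
  \<open>stream_space (measure_pmf p)\<close> is the law of an i.i.d. sequence with distribution \<open>p\<close>;
  \<open>N !! k\<close> is the number of tokens produced by the \<open>(k+1)\<close>-st round.
\<close>

definition expected_rounds :: "real \<Rightarrow> nat \<Rightarrow> nat \<Rightarrow> real" where
  "expected_rounds \<alpha> a b =
     (\<integral>N. real (LEAST r. 1 \<le> r \<and> b \<le> (\<Sum>k<r. N !! k))
        \<partial>stream_space (measure_pmf (map_pmf (\<lambda>g. 1 + g) (accepted_pmf \<alpha> a))))"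

text \<open>
  A call yields a pair (total cost, number of tokens passed up). A round obtains a batch from the
  call \<open>draft\<close>, verifies it at cost \<open>v\<close>, and yields (cost of the round, number of draft tokens
  accepted); it thus produces one token more than its second component.
\<close>

definition hsd_round :: "(real \<times> nat) pmf \<Rightarrow> real \<Rightarrow> real \<Rightarrow> (real \<times> nat) pmf" where
  "hsd_round draft v \<alpha> = do {
     (x, a) \<leftarrow> draft;
     g \<leftarrow> accepted_pmf \<alpha> a;
     return_pmf (x + v, g)
   }"

text \<open>
  Total cost of repeating \<open>rnd\<close> until at least \<open>b\<close> tokens have been produced, when \<open>n\<close> tokens
  have been produced already. As every round produces a token, there are only boundedly many rounds.
\<close>

function repeat_rounds :: "(real \<times> nat) pmf \<Rightarrow> nat \<Rightarrow> nat \<Rightarrow> real pmf" where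
  "repeat_rounds rnd b n = do {
     (x, g) \<leftarrow> rnd;
     if b \<le> n + (g + 1) then return_pmf x
     else map_pmf (\<lambda>y. x + y) (repeat_rounds rnd b (n + (g + 1)))
   }"
  by pat_completeness auto
termination
  by (relation "Wellfounded.measure (\<lambda>(_, b, n). b - n)") auto

declare repeat_rounds.simps [simp del]

text \<open>
  The call at level \<open>i\<close> of HSD with top level \<open>m\<close>; meaningful for \<open>i \<le> m\<close> and \<open>1 \<le> m\<close>.
\<close>

primrec hsd_call ::
  "(nat \<Rightarrow> real) \<Rightarrow> (nat \<Rightarrow> nat \<Rightarrow> real) \<Rightarrow> nat \<Rightarrow> (nat \<Rightarrow> nat) \<Rightarrow> (nat \<Rightarrow> nat) \<Rightarrow> nat \<Rightarrow> (real \<times> nat) pmf"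
where
  "hsd_call c \<alpha> m \<sigma> T 0 = return_pmf (real (T 0) * c (\<sigma> 0), T 0)"
| "hsd_call c \<alpha> m \<sigma> T (Suc i) =
     (let level_round = hsd_round (hsd_call c \<alpha> m \<sigma> T i) (c (\<sigma> (Suc i))) (\<alpha> (\<sigma> i) (\<sigma> (Suc i)))
      in if Suc i < m then map_pmf (\<lambda>x. (x, T (Suc i))) (repeat_rounds level_round (T (Suc i)) 0)
         else map_pmf (\<lambda>(x, g). (x, g + 1)) level_round)"

definition hsd_latency ::
  "(nat \<Rightarrow> real) \<Rightarrow> (nat \<Rightarrow> nat \<Rightarrow> real) \<Rightarrow> nat \<Rightarrow> (nat \<Rightarrow> nat) \<Rightarrow> (nat \<Rightarrow> nat) \<Rightarrow> real"
where
  "hsd_latency c \<alpha> m \<sigma> T =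
     measure_pmf.expectation (hsd_call c \<alpha> m \<sigma> T m) (\<lambda>(x, n). x) /
     measure_pmf.expectation (hsd_call c \<alpha> m \<sigma> T m) (\<lambda>(x, n). real n)"

text \<open>
  For \<open>p = 1\<close> the quotient in the first case is read as its limit, since division by zero
  would otherwise make it \<open>0\<close>.
\<close>

definition hsd_factor :: "nat \<Rightarrow> (nat \<Rightarrow> nat) \<Rightarrow> real \<Rightarrow> nat \<Rightarrow> real" where
  "hsd_factor m T p n =
     (if n = m then
        (if p = 1 then 1 / real (T (m - 1) + 1) else (1 - p) / (1 - p ^ (T (m - 1) + 1)))
      else if 1 \<le> n \<and> n < m then expected_rounds p (T (n - 1)) (T n)
      else real (T 0))"

end

theory Submission
  imports Defs
begin

text \<open>
  A call below the top level passes up a batch of fixed size, so the cost of one of its rounds is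
  independent of the number of tokens which that round produces. Wald's identity then gives the
  recursion \<open>C\<^sub>i = \<gamma>\<^sub>i (C\<^sub>i\<^sub>-\<^sub>1 + c\<^sub>i)\<close> for the expected costs, which unrolls to the sum of products.
  At the top level the expected number of output tokens is the geometric sum
  \<open>1 + \<alpha> + \<dots> + \<alpha>\<^sup>T\<close>.
\<close>

subsection \<open>Finitely supported distributions\<close>

text \<open>The tower property. Every \<open>pmf\<close> it is applied to has finite support, so
  integrability is automatic.\<close>

lemma expectation_bind_pmf_finite:
  fixes h :: "'b \<Rightarrow> real"
  assumes "finite (set_pmf p)" "\<And>x. x \<in> set_pmf p \<Longrightarrow> finite (set_pmf (f x))"
  shows "measure_pmf.expectation (p \<bind> f) h =
    measure_pmf.expectation p (\<lambda>x. measure_pmf.expectation (f x) h)"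
proof -
  have "measure_pmf.expectation (p \<bind> f) h =
      (\<Sum>a\<in>set_pmf p. pmf p a *\<^sub>R measure_pmf.expectation (f a) h)"
    using assms by (intro pmf_expectation_bind) auto
  also have "\<dots> = measure_pmf.expectation p (\<lambda>x. measure_pmf.expectation (f x) h)"
    using assms by (intro integral_measure_pmf [symmetric]) auto
  finally show ?thesis .
qed

subsection \<open>The number of accepted tokens\<close>

lemma accepted_pmf_0: "accepted_pmf \<alpha> 0 = return_pmf 0"
  by (simp add: accepted_pmf_def)

lemma accepted_pmf_Suc:
  "accepted_pmf \<alpha> (Suc a) =
     bernoulli_pmf \<alpha> \<bind> (\<lambda>b. if b then map_pmf Suc (accepted_pmf \<alpha> a) else return_pmf 0)"
  unfolding accepted_pmf_def
  by (auto simp: map_bind_pmf bind_map_pmf map_pmf_def bind_assoc_pmf bind_return_pmf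
      intro!: bind_pmf_cong)

lemma finite_set_accepted_pmf: "finite (set_pmf (accepted_pmf \<alpha> a))"
  by (induction a) (auto simp: accepted_pmf_0 accepted_pmf_Suc)

text \<open>The means \<open>e a\<close> satisfy \<open>e (Suc a) = 1 + \<alpha> * e a\<close>, the
  Horner recursion of the geometric sum. The bounds on \<open>\<alpha>\<close> keep
  \<open>bernoulli_pmf\<close> from clamping its parameter.\<close>

lemma expectation_Suc_accepted_pmf:
  assumes "0 \<le> \<alpha>" "\<alpha> \<le> 1"
  shows "measure_pmf.expectation (accepted_pmf \<alpha> a) (\<lambda>g. real (Suc g)) = (\<Sum>k\<le>a. \<alpha> ^ k)"
proof (induction a)
  case 0
  then show ?case by (simp add: accepted_pmf_0)
next
  case (Suc a)
  have int: "integrable (accepted_pmf \<alpha> a) f" for f :: "nat \<Rightarrow> real"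
    by (intro integrable_measure_pmf_finite finite_set_accepted_pmf)
  \<comment> \<open>Condition on the first draft token: acceptance adds one to the count for the
    other \<open>a\<close> tokens, rejection leaves \<open>Suc 0 = 1\<close>.\<close>
  have "measure_pmf.expectation (accepted_pmf \<alpha> (Suc a)) (\<lambda>g. real (Suc g)) =
      measure_pmf.expectation (accepted_pmf \<alpha> a) (\<lambda>g. 1 + real (Suc g)) * \<alpha> + (1 - \<alpha>)"
    unfolding accepted_pmf_Suc using assms
    by (subst expectation_bind_pmf_finite) (auto simp: finite_set_accepted_pmf add_ac)
  also have "\<dots> = 1 + \<alpha> * (\<Sum>k\<le>a. \<alpha> ^ k)"
    using Suc.IH by (subst Bochner_Integration.integral_add [OF int int]) (simp add: algebra_simps)
  also have "\<dots> = (\<Sum>k\<le>Suc a. \<alpha> ^ k)"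
    by (simp only: sum.atMost_Suc_shift) (simp add: sum_distrib_left)
  finally show ?case .
qed

subsection \<open>Wald's identity for the repeated rounds\<close>

lemma finite_set_repeat_rounds:
  assumes "finite (set_pmf rnd)"
  shows "finite (set_pmf (repeat_rounds rnd b n))"
  using assms
proof (induction rnd b n rule: repeat_rounds.induct)
  case (1 rnd b n)
  then show ?case
    by (subst repeat_rounds.simps) (auto split: prod.splits)
qed

text \<open>First-step analysis. Cost and acceptance count are independent under
  \<open>pair_pmf D A\<close>: the first round contributes the mean of \<open>D\<close> whatever its
  count, and the count alone decides how to go on.\<close>

lemma expectation_repeat_rounds_pair_pmf:
  assumes fin: "finite (set_pmf D)" "finite (set_pmf A)"
  shows "measure_pmf.expectation (repeat_rounds (pair_pmf D A) b n) (\<lambda>x. x) =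
    measure_pmf.expectation D (\<lambda>x. x) + measure_pmf.expectation A (\<lambda>g. if b \<le> n + (g + 1) then 0
      else measure_pmf.expectation (repeat_rounds (pair_pmf D A) b (n + (g + 1))) (\<lambda>x. x))"
    (is "_ = _ + measure_pmf.expectation A ?r")
proof -
  let ?R = "repeat_rounds (pair_pmf D A) b"
  have finR: "finite (set_pmf (?R k))" for k
    using fin by (intro finite_set_repeat_rounds) auto
  have intD: "integrable D f" and intA: "integrable A g" and intR: "integrable (?R k) h"
    for f h :: "real \<Rightarrow> real" and g :: "nat \<Rightarrow> real" and k
    using fin finR by (auto intro!: integrable_measure_pmf_finite)
  have "?R n = D \<bind> (\<lambda>x. A \<bind> (\<lambda>g. if b \<le> n + (g + 1) then return_pmf x
      else map_pmf (\<lambda>y. x + y) (?R (n + (g + 1)))))"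
    by (subst repeat_rounds.simps) (simp add: pair_pmf_def bind_assoc_pmf bind_return_pmf)
  then have "measure_pmf.expectation (?R n) (\<lambda>x. x) =
      measure_pmf.expectation D (\<lambda>x. measure_pmf.expectation A (\<lambda>g.
        measure_pmf.expectation (if b \<le> n + (g + 1) then return_pmf x
          else map_pmf (\<lambda>y. x + y) (?R (n + (g + 1)))) (\<lambda>x. x)))"
    using fin finR by (simp add: expectation_bind_pmf_finite)
  \<comment> \<open>Both branches contain the summand \<open>x\<close>, the cost of the first
    round.\<close>
  also have "\<dots> = measure_pmf.expectation D (\<lambda>x. measure_pmf.expectation A (\<lambda>g. x + ?r g))"
    by (intro Bochner_Integration.integral_cong refl)
      (simp add: Bochner_Integration.integral_add [OF intR intR])
  also have "\<dots> = measure_pmf.expectation D (\<lambda>x. x + measure_pmf.expectation A ?r)"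
    by (simp add: Bochner_Integration.integral_add [OF intA intA])
  also have "\<dots> = measure_pmf.expectation D (\<lambda>x. x) + measure_pmf.expectation A ?r"
    by (simp add: Bochner_Integration.integral_add [OF intD intD])
  finally show ?thesis .
qed

text \<open>With \<open>return_pmf 1\<close> as the cost of a round, \<open>repeat_rounds\<close> counts the rounds.\<close>

lemma wald_repeat_rounds:
  assumes "finite (set_pmf D)" "finite (set_pmf A)"
  shows "measure_pmf.expectation (repeat_rounds (pair_pmf D A) b n) (\<lambda>x. x) =
    measure_pmf.expectation (repeat_rounds (pair_pmf (return_pmf 1) A) b n) (\<lambda>x. x) *
    measure_pmf.expectation D (\<lambda>x. x)"
\<comment> \<open>Each round yields at least one token, so the deficit \<open>b - n\<close> drops as
  long as the target is not reached; the induction hypothesis is needed only in that branch.\<close>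
proof (induction "b - n" arbitrary: n rule: less_induct)
  case less
  let ?E = "\<lambda>D k. measure_pmf.expectation (repeat_rounds (pair_pmf D A) b k) (\<lambda>x. x)"
  let ?\<mu> = "measure_pmf.expectation D (\<lambda>x. x)"
  have "?E D n = ?\<mu> + measure_pmf.expectation A
      (\<lambda>g. if b \<le> n + (g + 1) then 0 else ?E D (n + (g + 1)))"
    using assms by (rule expectation_repeat_rounds_pair_pmf)
  also have "(\<lambda>g. if b \<le> n + (g + 1) then 0 else ?E D (n + (g + 1))) =
      (\<lambda>g. (if b \<le> n + (g + 1) then 0 else ?E (return_pmf 1) (n + (g + 1))) * ?\<mu>)"
    using less by (intro ext) simp
  also have "?\<mu> + measure_pmf.expectation A \<dots> =
      (1 + measure_pmf.expectation A
        (\<lambda>g. if b \<le> n + (g + 1) then 0 else ?E (return_pmf 1) (n + (g + 1)))) * ?\<mu>"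
    by (simp add: algebra_simps)
  also have "\<dots> = ?E (return_pmf 1) n * ?\<mu>"
    using assms by (subst expectation_repeat_rounds_pair_pmf [of "return_pmf 1"]) auto
  finally show ?case .
qed

subsection \<open>The number of rounds as a hitting time of an i.i.d. sequence\<close>

text \<open>The offset \<open>n\<close> of tokens already collected makes a first-step recursion
  possible; \<open>n = 0\<close> gives the quantity integrated in
  \<open>expected_rounds\<close>.\<close>

definition hitting_time :: "nat \<Rightarrow> nat \<Rightarrow> nat stream \<Rightarrow> nat" where
  "hitting_time b n N = (LEAST r. 1 \<le> r \<and> b \<le> n + (\<Sum>k<r. N !! k))"

lemma measurable_hitting_time [measurable]:
  "hitting_time b n \<in> measurable (stream_space (measure_pmf p)) (count_space UNIV)"
proof -
  \<comment> \<open>The coordinates map into \<open>measure_pmf p\<close>, whose sigma-algebra is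
    that of \<open>count_space UNIV\<close>.\<close>
  have "(\<lambda>N. N !! k) \<in> measurable (stream_space (measure_pmf p)) (count_space UNIV)" for k
    using measurable_snth [of k "measure_pmf p"] by (simp cong: measurable_cong_sets)
  note [measurable] = this
  show ?thesis unfolding hitting_time_def [abs_def] by measurable
qed

text \<open>Positive entries guarantee that the target is reached eventually, so that
  \<open>LEAST\<close> ranges over a nonempty set and can be shifted by one.\<close>

lemma hitting_time_SCons:
  assumes "\<And>k. 1 \<le> N !! k"
  shows "hitting_time b n (x ## N) = (if b \<le> n + x then 1 else Suc (hitting_time b (n + x) N))"
proof (cases "b \<le> n + x")
  case True
  then show ?thesis unfolding hitting_time_def by (auto intro!: Least_equality)
next
  case False
  \<comment> \<open>The first \<open>b\<close> entries sum to at least \<open>b\<close>, so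
    \<open>Suc b\<close> is a witness for \<open>Least_Suc\<close>.\<close>
  have "(\<Sum>k<b. 1) \<le> (\<Sum>k<b. N !! k)"
    using assms by (intro sum_mono)
  then have b: "b \<le> (\<Sum>k<b. N !! k)" by simp
  have "hitting_time b n (x ## N) =
      Suc (LEAST r. 1 \<le> Suc r \<and> b \<le> n + (\<Sum>k<Suc r. (x ## N) !! k))"
    unfolding hitting_time_def using b
    by (intro Least_Suc [of _ "Suc b"]) (auto simp: sum.lessThan_Suc_shift simp del: sum.lessThan_Suc)
  \<comment> \<open>At \<open>r = 0\<close> the left side fails because \<open>n + x < b\<close>,
    the right side because of \<open>1 \<le> r\<close>.\<close>
  also have "(\<lambda>r. 1 \<le> Suc r \<and> b \<le> n + (\<Sum>k<Suc r. (x ## N) !! k)) =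
      (\<lambda>r. 1 \<le> r \<and> b \<le> n + x + (\<Sum>k<r. N !! k))"
  proof
    fix r
    show "(1 \<le> Suc r \<and> b \<le> n + (\<Sum>k<Suc r. (x ## N) !! k)) =
        (1 \<le> r \<and> b \<le> n + x + (\<Sum>k<r. N !! k))"
      using False
      by (cases r) (auto simp: sum.lessThan_Suc_shift add_ac simp del: sum.lessThan_Suc)
  qed
  finally show ?thesis using False by (simp add: hitting_time_def)
qed

text \<open>Nonnegativity lets expected costs be computed as nonnegative integrals, where
  \<open>ennreal\<close> is additive.\<close>

lemma repeat_rounds_nonneg:
  assumes "\<And>x g. (x, g) \<in> set_pmf rnd \<Longrightarrow> 0 \<le> x" "y \<in> set_pmf (repeat_rounds rnd b n)"
  shows "0 \<le> y"
  using assms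
proof (induction rnd b n arbitrary: y rule: repeat_rounds.induct)
  case (1 rnd b n)
  from 1(3) obtain x g where xg: "(x, g) \<in> set_pmf rnd"
    and "y = x \<or> (\<not> b \<le> n + (g + 1) \<and> (\<exists>z. z \<in> set_pmf (repeat_rounds rnd b (n + (g + 1))) \<and> y = x + z))"
    by (subst (asm) repeat_rounds.simps) (auto split: if_splits)
  then show ?case
    using 1(1) [OF xg refl] 1(2) by (metis add_nonneg_nonneg)
qed

text \<open>Both sides obey the same recursion: one by splitting off the first stream entry, the
  other by unfolding one round. Nonnegative integrals avoid an integrability proof on the infinite
  product.\<close>

lemma nn_integral_hitting_time:
  fixes A :: "nat pmf"
  defines "S \<equiv> stream_space (measure_pmf (map_pmf Suc A))"
  shows "(\<integral>\<^sup>+N. ennreal (real (hitting_time b n N)) \<partial>S) =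
    (\<integral>\<^sup>+x. ennreal x \<partial>repeat_rounds (pair_pmf (return_pmf 1) A) b n)"
proof (induction "b - n" arbitrary: n rule: less_induct)
  case less
  let ?R = "repeat_rounds (pair_pmf (return_pmf 1) A) b"
  let ?p = "map_pmf Suc A"
  interpret S: prob_space S
    unfolding S_def by (intro prob_space.prob_space_stream_space prob_space_measure_pmf)
  have meas [measurable]: "hitting_time b k \<in> measurable S (count_space UNIV)" for k
    unfolding S_def by measurable
  \<comment> \<open>Entries drawn from \<open>map_pmf Suc A\<close> are positive, so
    \<open>hitting_time_SCons\<close> applies almost surely.\<close>
  have AE: "AE N in S. \<forall>k. 1 \<le> N !! k"
    unfolding S_def using prob_space.AE_stream_all [of "measure_pmf ?p" "\<lambda>x. 1 \<le> x"] prob_space_measure_pmf [of ?p]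
    by (simp add: AE_measure_pmf_iff sset_range)
  have step: "(\<integral>\<^sup>+N. ennreal (real (hitting_time b n (Suc g ## N))) \<partial>S) =
      (if b \<le> n + (g + 1) then 1 else \<integral>\<^sup>+y. ennreal (1 + y) \<partial>?R (n + (g + 1)))" for g
  proof -
    have "(\<integral>\<^sup>+N. ennreal (real (hitting_time b n (Suc g ## N))) \<partial>S) =
        (\<integral>\<^sup>+N. (if b \<le> n + (g + 1) then 1
          else 1 + ennreal (real (hitting_time b (n + (g + 1)) N))) \<partial>S)"
      using AE by (intro nn_integral_cong_AE, eventually_elim)
        (auto simp: hitting_time_SCons ennreal_plus simp flip: ennreal_1)
    also have "\<dots> = (if b \<le> n + (g + 1) then 1
        else 1 + (\<integral>\<^sup>+N. ennreal (real (hitting_time b (n + (g + 1)) N)) \<partial>S))"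
      by (simp add: nn_integral_add S.emeasure_space_1)
    also have "\<dots> = (if b \<le> n + (g + 1) then 1
        else 1 + (\<integral>\<^sup>+y. ennreal y \<partial>?R (n + (g + 1))))"
      using less by simp
    also have "1 + (\<integral>\<^sup>+y. ennreal y \<partial>?R k) = (\<integral>\<^sup>+y. 1 + ennreal y \<partial>?R k)" for k
      by (subst nn_integral_add) auto
    also have "(\<integral>\<^sup>+y. 1 + ennreal y \<partial>?R k) = (\<integral>\<^sup>+y. ennreal (1 + y) \<partial>?R k)" for k
      by (intro nn_integral_cong_AE)
        (auto simp: AE_measure_pmf_iff intro!: ennreal_plus [symmetric, of 1, simplified]
          elim!: repeat_rounds_nonneg [rotated])
    finally show ?thesis .
  qed
  \<comment> \<open>An i.i.d. stream is an independent first entry followed by a stream of the same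
    law.\<close>
  have "(\<integral>\<^sup>+N. ennreal (real (hitting_time b n N)) \<partial>S) =
      (\<integral>\<^sup>+g. \<integral>\<^sup>+N. ennreal (real (hitting_time b n (Suc g ## N))) \<partial>S \<partial>A)"
    unfolding S_def by (subst prob_space.nn_integral_stream_space [OF prob_space_measure_pmf]) auto
  also have "\<dots> = (\<integral>\<^sup>+x. ennreal x \<partial>?R n)"
    unfolding step
    by (subst repeat_rounds.simps)
      (auto simp: pair_pmf_def bind_assoc_pmf bind_return_pmf intro!: nn_integral_cong)
  finally show ?case .
qed

text \<open>Identifies \<open>\<gamma>\<close> with the mean of the round-counting program that
  appears in Wald's identity.\<close>

lemma expected_rounds_eq:
  "expected_rounds \<alpha> a b =
    measure_pmf.expectation (repeat_rounds (pair_pmf (return_pmf 1) (accepted_pmf \<alpha> a)) b 0) (\<lambda>x. x)"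
proof -
  let ?A = "accepted_pmf \<alpha> a"
  let ?R = "repeat_rounds (pair_pmf (return_pmf 1) ?A) b 0"
  let ?S = "stream_space (measure_pmf (map_pmf Suc ?A))"
  have "expected_rounds \<alpha> a b = (\<integral>N. real (hitting_time b 0 N) \<partial>?S)"
    by (simp add: expected_rounds_def hitting_time_def)
  also have "\<dots> = enn2real (\<integral>\<^sup>+N. ennreal (real (hitting_time b 0 N)) \<partial>?S)"
    by (intro integral_eq_nn_integral) auto
  also have "\<dots> = enn2real (\<integral>\<^sup>+x. ennreal x \<partial>?R)"
    by (simp add: nn_integral_hitting_time)
  also have "\<dots> = measure_pmf.expectation ?R (\<lambda>x. x)"
    by (intro integral_eq_nn_integral [symmetric])
      (auto simp: AE_measure_pmf_iff elim!: repeat_rounds_nonneg [rotated])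
  finally show ?thesis .
qed

subsection \<open>Expected costs of the calls\<close>

text \<open>A fixed batch size makes the verification independent of the drafting cost, so the round
  is a product law.\<close>

lemma hsd_round_eq_pair_pmf:
  "hsd_round (map_pmf (\<lambda>x. (x, a)) D) v \<alpha> = pair_pmf (map_pmf (\<lambda>x. x + v) D) (accepted_pmf \<alpha> a)"
  by (simp add: hsd_round_def pair_pmf_def bind_map_pmf)

text \<open>\<open>D\<close> is the law of the cost alone. The constant second component
  \<open>T i\<close> is carried through the induction because the product form of the next round
  rests on it.\<close>

lemma hsd_call_below_top:
  assumes "i < m"
  shows "\<exists>D. finite (set_pmf D) \<and> hsd_call c \<alpha> m \<sigma> T i = map_pmf (\<lambda>x. (x, T i)) D \<and>
    measure_pmf.expectation D (\<lambda>x. x) =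
      (\<Sum>k=0..i. c (\<sigma> k) * (\<Prod>j=k..i. hsd_factor m T (\<alpha> (\<sigma> (j - 1)) (\<sigma> j)) j))"
  using assms
proof (induction i)
  case 0
  \<comment> \<open>For \<open>j = 0\<close>, \<open>\<sigma> (j - 1)\<close> denotes
    \<open>\<sigma> 0\<close> and the factor is \<open>T 0\<close>, the number of drafted
    tokens.\<close>
  then show ?case
    by (intro exI [of _ "return_pmf (real (T 0) * c (\<sigma> 0))"]) (simp add: hsd_factor_def)
next
  case (Suc i)
  let ?F = "\<lambda>j. hsd_factor m T (\<alpha> (\<sigma> (j - 1)) (\<sigma> j)) j"
  let ?v = "c (\<sigma> (Suc i))" and ?A = "accepted_pmf (\<alpha> (\<sigma> i) (\<sigma> (Suc i))) (T i)"
  from Suc obtain D where D: "finite (set_pmf D)" "hsd_call c \<alpha> m \<sigma> T i = map_pmf (\<lambda>x. (x, T i)) D"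
    "measure_pmf.expectation D (\<lambda>x. x) = (\<Sum>k=0..i. c (\<sigma> k) * (\<Prod>j=k..i. ?F j))"
    by auto
  have int: "integrable D f" for f :: "real \<Rightarrow> real"
    using D(1) by (rule integrable_measure_pmf_finite)
  define D' where "D' = repeat_rounds (pair_pmf (map_pmf (\<lambda>x. x + ?v) D) ?A) (T (Suc i)) 0"
  have "hsd_call c \<alpha> m \<sigma> T (Suc i) = map_pmf (\<lambda>x. (x, T (Suc i))) D'"
    using Suc.prems by (simp add: D(2) hsd_round_eq_pair_pmf D'_def)
  moreover have "finite (set_pmf D')"
    unfolding D'_def using D(1) by (intro finite_set_repeat_rounds) (auto simp: finite_set_accepted_pmf)
  moreover have "measure_pmf.expectation D' (\<lambda>x. x) =
      (\<Sum>k=0..Suc i. c (\<sigma> k) * (\<Prod>j=k..Suc i. ?F j))"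
  proof -
    have "measure_pmf.expectation D' (\<lambda>x. x) =
        ?F (Suc i) * measure_pmf.expectation D (\<lambda>x. x + ?v)"
      unfolding D'_def using D(1) Suc.prems
      by (subst wald_repeat_rounds) (auto simp: finite_set_accepted_pmf hsd_factor_def expected_rounds_eq)
    also have "\<dots> = ?F (Suc i) * ((\<Sum>k=0..i. c (\<sigma> k) * (\<Prod>j=k..i. ?F j)) + ?v)"
      by (simp add: Bochner_Integration.integral_add [OF int int] D(3))
    \<comment> \<open>The new factor extends every old product, and its product with
      \<open>?v\<close> is the summand \<open>k = Suc i\<close>.\<close>
    also have "\<dots> = (\<Sum>k=0..Suc i. c (\<sigma> k) * (\<Prod>j=k..Suc i. ?F j))"
      by (simp add: distrib_left sum_distrib_left mult_ac del: prod.cl_ivl_Suc)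
        (auto intro!: sum.cong simp: mult_ac)
    finally show ?thesis .
  qed
  ultimately show ?case by blast
qed

text \<open>The closed form of the geometric sum; at \<open>p = 1\<close> the sum is
  \<open>T (m - 1) + 1\<close>, in agreement with the limit convention.\<close>

lemma hsd_factor_top:
  assumes "0 < m"
  shows "hsd_factor m T p m = 1 / (\<Sum>k\<le>T (m - 1). p ^ k)"
  using assms by (simp add: hsd_factor_def sum_gp0)

theorem corollary3p1:
  fixes K m :: nat
    and c :: "nat \<Rightarrow> real"
    and \<alpha> :: "nat \<Rightarrow> nat \<Rightarrow> real"
    and \<sigma> T :: "nat \<Rightarrow> nat"
  assumes "\<And>i. i \<le> K \<Longrightarrow> c i > 0"
    and "\<And>i j. i \<le> K \<Longrightarrow> j \<le> K \<Longrightarrow> \<alpha> i j \<in> {0..1}"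
    and "m \<ge> 1"
    and "strict_mono_on {0..m} \<sigma>"
    and "\<sigma> m = K"
    and "\<And>i. i < m \<Longrightarrow> T i > 0"
  shows "hsd_latency c \<alpha> m \<sigma> T =
    (\<Sum>i=0..m. c (\<sigma> i) * (\<Prod>j=i..m. hsd_factor m T (\<alpha> (\<sigma> (j - 1)) (\<sigma> j)) j))"
proof -
  let ?F = "\<lambda>j. hsd_factor m T (\<alpha> (\<sigma> (j - 1)) (\<sigma> j)) j"
  obtain i where m: "m = Suc i" using assms(3) by (cases m) auto
  let ?p = "\<alpha> (\<sigma> i) (\<sigma> m)" and ?v = "c (\<sigma> m)"
  let ?A = "accepted_pmf ?p (T i)"
  \<comment> \<open>With \<open>\<sigma> m = K\<close> this puts both indices in the range where
    acceptance rates lie in \<open>{0..1}\<close>.\<close>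
  have "\<sigma> i < \<sigma> m"
    using strict_mono_onD [OF assms(4), of i m] m by simp
  then have p: "0 \<le> ?p" "?p \<le> 1"
    using assms(2) [of "\<sigma> i" "\<sigma> m"] assms(5) by auto
  obtain D where D: "finite (set_pmf D)" "hsd_call c \<alpha> m \<sigma> T i = map_pmf (\<lambda>x. (x, T i)) D"
    "measure_pmf.expectation D (\<lambda>x. x) = (\<Sum>k=0..i. c (\<sigma> k) * (\<Prod>j=k..i. ?F j))"
    using hsd_call_below_top [of i m c \<alpha> \<sigma> T] m by auto
  have int: "integrable D f" for f :: "real \<Rightarrow> real"
    using D(1) by (rule integrable_measure_pmf_finite)
  define rnd where "rnd = pair_pmf (map_pmf (\<lambda>x. x + ?v) D) ?A"
  have call: "hsd_call c \<alpha> m \<sigma> T m = map_pmf (\<lambda>(x, g). (x, g + 1)) rnd"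
    using D(2) by (simp add: m hsd_round_eq_pair_pmf rnd_def)
  \<comment> \<open>The single top round is a product law, so expected cost and expected output are
    read off its two marginals.\<close>
  have "measure_pmf.expectation (hsd_call c \<alpha> m \<sigma> T m) (\<lambda>(x, n). x) =
      measure_pmf.expectation (map_pmf fst rnd) (\<lambda>x. x)"
    by (simp add: call case_prod_beta)
  also have "\<dots> = (\<Sum>k=0..i. c (\<sigma> k) * (\<Prod>j=k..i. ?F j)) + ?v"
    unfolding rnd_def map_fst_pair_pmf
    by (simp add: Bochner_Integration.integral_add [OF int int] D(3))
  finally have cost: "measure_pmf.expectation (hsd_call c \<alpha> m \<sigma> T m) (\<lambda>(x, n). x) = \<dots>" .
  have "measure_pmf.expectation (hsd_call c \<alpha> m \<sigma> T m) (\<lambda>(x, n). real n) =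
      measure_pmf.expectation (map_pmf snd rnd) (\<lambda>g. real (Suc g))"
    by (simp add: call case_prod_beta)
  also have "\<dots> = (\<Sum>k\<le>T i. ?p ^ k)"
    unfolding rnd_def map_snd_pair_pmf using p by (rule expectation_Suc_accepted_pmf)
  finally have "measure_pmf.expectation (hsd_call c \<alpha> m \<sigma> T m) (\<lambda>(x, n). real n) = \<dots>" .
  \<comment> \<open>Dividing by the expected output, a geometric sum, is multiplication by the top
    factor \<open>?F m\<close>.\<close>
  then have "hsd_latency c \<alpha> m \<sigma> T = ((\<Sum>k=0..i. c (\<sigma> k) * (\<Prod>j=k..i. ?F j)) + ?v) * ?F m"
    using hsd_factor_top [of m T ?p] m unfolding hsd_latency_def cost by simp
  also have "\<dots> = (\<Sum>k=0..m. c (\<sigma> k) * (\<Prod>j=k..m. ?F j))"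
    by (simp add: m distrib_right sum_distrib_right mult.assoc)
  finally show ?thesis .
qed

end
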